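(* Let $r\geq 3$ and $n=3r-2$. Then the $2$-packing number of the Kneser graph $K(n,r)$ is $$\rho(K(n,r))=\begin{cases}7, & \text{if } r=3,\\ 5, & \text{if } r=4,\\ 3, & \text{if } r\geq 5.\end{cases}$$
   Context: For positive integers $n\geq 2r$, the Kneser graph $K(n,r)$ has as vertices the $r$-subsets of $[n]=\{1,\dots,n\}$, two vertices being adjacent iff they are disjoint. For a vertex $v$, $N[v]$ denotes its closed neighbourhood (the vertex together with its neighbours). A $2$-packing of a graph $G$ is a set $S\subseteq V(G)$ such that $N[u]\cap N[v]=\emptyset$ for all distinct $u,v\in S$; the $2$-packing number $\rho(G)$ is the maximum cardinality of a $2$-packing of $G$. *)

theory Defs
  imports "Graph_Theory.Pair_Digraph"
begin

text \<open>
  As in the imported theory, undirected graphs are symmetric digraphs. The definitions of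
  closed neighbourhood, packing and packing number are intended for such graphs.
\<close>

definition kneser_graph :: "nat \<Rightarrow> nat \<Rightarrow> nat set pair_pre_digraph" where
  "kneser_graph n r =
     (let V = {A. A \<subseteq> {1..n} \<and> card A = r}
      in \<lparr>pverts = V, parcs = {(A, B). A \<in> V \<and> B \<in> V \<and> A \<inter> B = {}}\<rparr>)"

text \<open>For \<open>r = 0\<close> the empty set would carry a loop.\<close>

lemma pair_graph_kneser_graph:
  assumes "0 < r"
  shows "pair_graph (kneser_graph n r)"
proof
  show fin: "finite (pverts (kneser_graph n r))"
    by (rule finite_subset[of _ "Pow {1..n}"]) (auto simp: kneser_graph_def)
  have "parcs (kneser_graph n r) \<subseteq> pverts (kneser_graph n r) \<times> pverts (kneser_graph n r)"
    by (auto simp: kneser_graph_def Let_def)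
  then show "finite (parcs (kneser_graph n r))"
    using fin by (meson finite_SigmaI finite_subset)
  show "symmetric (kneser_graph n r)"
  proof -
    have "sym (parcs (kneser_graph n r))"
      unfolding sym_def by (simp add: kneser_graph_def Int_commute)
    then show ?thesis
      by (simp only: symmetric_def with_proj_simps)
  qed
next
  fix e
  assume "e \<in> parcs (kneser_graph n r)"
  then obtain A B where e: "e = (A, B)" and "A \<subseteq> {1..n}" "card A = r"
    and "B \<subseteq> {1..n}" "card B = r" and disj: "A \<inter> B = {}"
    by (cases e) (simp add: kneser_graph_def)
  then show "fst e \<in> pverts (kneser_graph n r)" "snd e \<in> pverts (kneser_graph n r)"
    by (simp_all add: kneser_graph_def)
  have "A \<noteq> {}"
    using assms \<open>card A = r\<close> by force
  with e disj show "fst e \<noteq> snd e"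
    by force
qed

definition closed_neighbourhood :: "('a, 'b) pre_digraph \<Rightarrow> 'a \<Rightarrow> 'a set" where
  "closed_neighbourhood G v = insert v {w. v \<rightarrow>\<^bsub>G\<^esub> w}"

definition two_packing :: "('a, 'b) pre_digraph \<Rightarrow> 'a set \<Rightarrow> bool" where
  "two_packing G S \<longleftrightarrow> S \<subseteq> verts G \<and>
     (\<forall>u\<in>S. \<forall>v\<in>S. u \<noteq> v \<longrightarrow> closed_neighbourhood G u \<inter> closed_neighbourhood G v = {})"

text \<open>Meaningful for finite \<open>G\<close>: then the set below is finite, and it always contains
  \<open>card {}\<close>.\<close>

definition packing_number :: "('a, 'b) pre_digraph \<Rightarrow> nat" where
  "packing_number G = Max {card S | S. two_packing G S}"

end

theory Submission
  imports Defs
begin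

text \<open>
  When \<open>n = 3 * r - 2\<close>, two distinct \<open>r\<close>-sets have disjoint closed neighbourhoods iff they
  share exactly one point: at least one since they are not adjacent, and at most one since
  otherwise the complement of their union has room for a common neighbour. If \<open>k\<close> such sets
  cover the point \<open>x\<close> exactly \<open>d x\<close> times, then the sum of \<open>d x\<close> is \<open>k * r\<close> and the sum of
  \<open>d x * (d x - 1)\<close> is \<open>k * (k - 1)\<close>. As \<open>(d x - c) * (d x - c - 1) \<ge> 0\<close> for every integer
  \<open>c\<close>, summation over \<open>x\<close> excludes \<open>k = 8, 6, 4\<close> with \<open>c = 3, 2, 1\<close> for \<open>r = 3\<close>, \<open>r = 4\<close>,
  \<open>r \<ge> 5\<close> respectively. The bounds are attained by the Fano plane, by the vertex stars of \<open>K\<^sub>5\<close>,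
  and by three sets through a common point.
\<close>

lemma packing_number_eqI:
  assumes "two_packing G S" and "card S = k"
    and le: "\<And>T. two_packing G T \<Longrightarrow> card T \<le> k"
  shows "packing_number G = k"
  unfolding packing_number_def
proof (rule Max_eqI)
  \<comment> \<open>The upper bound also supplies the finiteness without which \<open>Max\<close>
    says nothing.\<close>
  show "finite {card S |S. two_packing G S}"
    by (rule finite_subset[of _ "{..k}"]) (auto dest: le)
qed (use assms in auto)

lemma two_packing_subset:
  "two_packing G S \<Longrightarrow> T \<subseteq> S \<Longrightarrow> two_packing G T"
  unfolding two_packing_def by blast

lemma verts_kneser_graph:
  "verts (with_proj (kneser_graph n r)) = {A. A \<subseteq> {1..n} \<and> card A = r}"
  by (simp add: kneser_graph_def Let_def)

lemma closed_neighbourhood_kneser_graph: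
  assumes "A \<subseteq> {1..n}" "card A = r"
  shows "closed_neighbourhood (kneser_graph n r) A =
    insert A {B. B \<subseteq> {1..n} \<and> card B = r \<and> A \<inter> B = {}}"
  using assms by (auto simp: closed_neighbourhood_def kneser_graph_def Let_def)

lemma closed_neighbourhoods_disjoint_iff:
  assumes n: "n = 3 * r - 2" and "0 < r" "A \<noteq> B"
    and A: "A \<subseteq> {1..n}" "card A = r" and B: "B \<subseteq> {1..n}" "card B = r"
  shows "closed_neighbourhood (kneser_graph n r) A \<inter> closed_neighbourhood (kneser_graph n r) B = {}
    \<longleftrightarrow> card (A \<inter> B) = 1"
proof -
  have fin: "finite A" "finite B"
    using A B finite_subset by blast+
  have un: "card (A \<union> B) + card (A \<inter> B) = 2 * r"
    using card_Un_Int[OF fin] A B by simp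
  have sub: "A \<union> B \<subseteq> {1..n}"
    using A B by blast
  show ?thesis
  proof
    assume disj: "closed_neighbourhood (kneser_graph n r) A \<inter>
      closed_neighbourhood (kneser_graph n r) B = {}"
    then have "A \<inter> B \<noteq> {}"
      using A B by (auto simp: closed_neighbourhood_kneser_graph)
    then have pos: "card (A \<inter> B) > 0"
      using fin by (simp add: card_gt_0_iff)
    have "card (A \<inter> B) < 2"
    proof (rule ccontr)
      assume "\<not> card (A \<inter> B) < 2"
      \<comment> \<open>The complement has (3r - 2) - (2r - |A \<inter> B|) = r - 2 + |A \<inter> B|
        points.\<close>
      then have "r \<le> card ({1..n} - (A \<union> B))"
        using un n fin sub by (simp add: card_Diff_subset)
      then obtain C where "C \<subseteq> {1..n} - (A \<union> B)" "card C = r"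
        by (meson obtain_subset_with_card_n)
      then have "C \<in> closed_neighbourhood (kneser_graph n r) A \<inter>
          closed_neighbourhood (kneser_graph n r) B"
        using A B by (auto simp: closed_neighbourhood_kneser_graph)
      with disj show False
        by simp
    qed
    with pos show "card (A \<inter> B) = 1"
      by simp
  next
    assume one: "card (A \<inter> B) = 1"
    then have meet: "A \<inter> B \<noteq> {}"
      by auto
    have "False" if C: "C \<subseteq> {1..n}" "card C = r" "A \<inter> C = {}" "B \<inter> C = {}" for C
    proof -
      \<comment> \<open>A common neighbour would need (2r - 1) + r = n + 1 points in all.\<close>
      have "card (A \<union> B \<union> C) = card (A \<union> B) + card C"
        using C fin by (intro card_Un_disjoint) (auto intro: finite_subset)
      moreover have "card (A \<union> B \<union> C) \<le> n"
        using card_mono[of "{1..n}" "A \<union> B \<union> C"] sub C by simp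
      ultimately show False
        using un one C n \<open>0 < r\<close> by simp
    qed
    with meet show "closed_neighbourhood (kneser_graph n r) A \<inter>
      closed_neighbourhood (kneser_graph n r) B = {}"
      using A B \<open>A \<noteq> B\<close> by (auto simp: closed_neighbourhood_kneser_graph)
  qed
qed

lemma two_packing_kneser_graph_iff:
  assumes "n = 3 * r - 2" and "0 < r"
  shows "two_packing (kneser_graph n r) S \<longleftrightarrow>
    (\<forall>A\<in>S. A \<subseteq> {1..n} \<and> card A = r) \<and> (\<forall>A\<in>S. \<forall>B\<in>S. A \<noteq> B \<longrightarrow> card (A \<inter> B) = 1)"
proof (cases "\<forall>A\<in>S. A \<subseteq> {1..n} \<and> card A = r")
  case True
  then have "S \<subseteq> verts (kneser_graph n r)"
    by (simp only: verts_kneser_graph) blast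
  with True show ?thesis
    unfolding two_packing_def
    by (simp add: closed_neighbourhoods_disjoint_iff[OF assms])
next
  case False
  then show ?thesis
    unfolding two_packing_def verts_kneser_graph by blast
qed

lemma sum_degree_quadratic_nonneg:
  fixes S :: "'a set set" and c :: int
  assumes "finite X" "finite S" and sub: "\<And>A. A \<in> S \<Longrightarrow> A \<subseteq> X"
    and r: "\<And>A. A \<in> S \<Longrightarrow> card A = r"
    and one: "\<And>A B. A \<in> S \<Longrightarrow> B \<in> S \<Longrightarrow> A \<noteq> B \<Longrightarrow> card (A \<inter> B) = 1"
  shows "0 \<le> int (card S) * (int (card S) - 1) - 2 * c * (int (card S) * int r)
    + c * (c + 1) * int (card X)"
proof -
  \<comment> \<open>Integer-valued, since \<open>d x - c\<close> may be negative.\<close>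
  define d :: "'a \<Rightarrow> int" where "d x = (\<Sum>A\<in>S. of_bool (x \<in> A))" for x
  have count: "(\<Sum>x\<in>X. of_bool (x \<in> A)) = int (card A)" if "A \<subseteq> X" for A
    using that \<open>finite X\<close> by (simp add: Int_absorb1 sum.If_cases of_bool_def)
  have "(\<Sum>x\<in>X. d x) = (\<Sum>A\<in>S. \<Sum>x\<in>X. of_bool (x \<in> A))"
    unfolding d_def by (rule sum.swap)
  also have "\<dots> = (\<Sum>A\<in>S. int r)"
    using count sub r by (intro sum.cong) auto
  finally have d1: "(\<Sum>x\<in>X. d x) = int (card S) * int r"
    by simp
  \<comment> \<open>\<open>d x * d x\<close> counts the ordered pairs of members through
    \<open>x\<close>, including \<open>A = B\<close>; the diagonal contributes \<open>r\<close> per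
    member, each other pair 1.\<close>
  have "(\<Sum>x\<in>X. d x * d x) = (\<Sum>x\<in>X. \<Sum>A\<in>S. \<Sum>B\<in>S. of_bool (x \<in> A \<inter> B))"
    unfolding d_def sum_product by (intro sum.cong) auto
  also have "\<dots> = (\<Sum>A\<in>S. \<Sum>x\<in>X. \<Sum>B\<in>S. of_bool (x \<in> A \<inter> B))"
    by (rule sum.swap)
  also have "\<dots> = (\<Sum>A\<in>S. \<Sum>B\<in>S. \<Sum>x\<in>X. of_bool (x \<in> A \<inter> B))"
    by (intro sum.cong refl sum.swap)
  also have "\<dots> = (\<Sum>A\<in>S. \<Sum>B\<in>S. int (card (A \<inter> B)))"
    using sub by (intro sum.cong refl count) auto
  also have "\<dots> = (\<Sum>A\<in>S. int r + (int (card S) - 1))"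
  proof (intro sum.cong refl)
    fix A assume A: "A \<in> S"
    have "(\<Sum>B\<in>S. int (card (A \<inter> B))) = int (card A) + (\<Sum>B\<in>S - {A}. int (card (A \<inter> B)))"
      using A \<open>finite S\<close> by (simp add: sum.remove)
    also have "(\<Sum>B\<in>S - {A}. int (card (A \<inter> B))) = (\<Sum>B\<in>S - {A}. 1)"
      using A one by (intro sum.cong refl) fastforce
    also have "\<dots> = int (card (S - {A}))"
      by simp
    also have "\<dots> = int (card S) - 1"
      using card_Suc_Diff1[OF \<open>finite S\<close> A] by linarith
    finally show "(\<Sum>B\<in>S. int (card (A \<inter> B))) = int r + (int (card S) - 1)"
      using r A by simp
  qed
  finally have d2: "(\<Sum>x\<in>X. d x * d x) = int (card S) * (int r + (int (card S) - 1))"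
    by simp
  \<comment> \<open>Two consecutive integers never have strictly opposite signs.\<close>
  have "0 \<le> (d x - c) * (d x - (c + 1))" for x
    by (cases "d x \<le> c") (auto intro: mult_nonpos_nonpos mult_nonneg_nonneg)
  then have "0 \<le> (\<Sum>x\<in>X. (d x - c) * (d x - (c + 1)))"
    by (intro sum_nonneg) auto
  also have "\<dots> = (\<Sum>x\<in>X. d x * d x - (2 * c + 1) * d x + c * (c + 1))"
    by (intro sum.cong) (auto simp: algebra_simps)
  also have "\<dots> = (\<Sum>x\<in>X. d x * d x) - (2 * c + 1) * (\<Sum>x\<in>X. d x) + c * (c + 1) * int (card X)"
    by (simp add: sum.distrib sum_subtractf sum_distrib_left)
  finally show ?thesis
    unfolding d1 d2 by (simp add: algebra_simps)
qed

text \<open>The quadratic in the family size becomes nonnegative again for large families, so it is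
  tested only at size \<open>k + 1\<close>, on a subfamily of a supposedly larger packing.\<close>

lemma card_two_packing_kneser_graph_le:
  fixes c :: int
  assumes n: "n = 3 * r - 2" "0 < r"
    and neg: "int (k + 1) * int k - 2 * c * (int (k + 1) * int r) + c * (c + 1) * int n < 0"
    and T: "two_packing (kneser_graph n r) T"
  shows "card T \<le> k"
proof (rule ccontr)
  assume "\<not> card T \<le> k"
  then obtain S where S: "S \<subseteq> T" "card S = k + 1" "finite S"
    by (metis obtain_subset_with_card_n Suc_eq_plus1 not_less_eq_eq)
  then have "two_packing (kneser_graph n r) S"
    using T two_packing_subset by blast
  then show False
    using sum_degree_quadratic_nonneg[of "{1..n}" S r c] S neg
    by (simp add: two_packing_kneser_graph_iff[OF n])
qed

theorem theorem4:
  fixes n r :: nat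
  assumes "r \<ge> 3" and "n = 3 * r - 2"
  shows "packing_number (kneser_graph n r) = (if r = 3 then 7 else if r = 4 then 5 else 3)"
proof -
  have r0: "0 < r"
    using assms by simp
  note packing_iff = two_packing_kneser_graph_iff[OF assms(2) r0]
  note packing_le = card_two_packing_kneser_graph_le[OF assms(2) r0]
  consider "r = 3" | "r = 4" | "r \<ge> 5"
    using assms by linarith
  then show ?thesis
  proof cases
    case 1
    let ?S = "{{1,2,3}, {1,4,5}, {1,6,7}, {2,4,6}, {2,5,7}, {3,4,7}, {3,5,6}} :: nat set set"
    have "packing_number (kneser_graph n r) = 7"
    proof (rule packing_number_eqI)
      show "two_packing (kneser_graph n r) ?S"
        unfolding packing_iff using assms 1 by simp
      show "card ?S = 7"
        by (simp add: set_eq_subset)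
      show "card T \<le> 7" if "two_packing (kneser_graph n r) T" for T
        \<comment> \<open>Here and in the other cases \<open>c\<close> is the integer part of the
          average degree (k + 1)r/n, here 24/7. The value is 56 - 144 + 84 = -4.\<close>
        by (rule packing_le[OF _ that, of _ 3]) (use assms 1 in simp)
    qed
    with 1 show ?thesis
      by simp
  next
    case 2
    \<comment> \<open>The points 1 to 10 are the edges of the complete graph on five vertices in
      lexicographic order; two stars share the edge joining their centres.\<close>
    let ?S = "{{1,2,3,4}, {1,5,6,7}, {2,5,8,9}, {3,6,8,10}, {4,7,9,10}} :: nat set set"
    have "packing_number (kneser_graph n r) = 5"
    proof (rule packing_number_eqI)
      show "two_packing (kneser_graph n r) ?S"
        unfolding packing_iff using assms 2 by simp
      show "card ?S = 5"
        by (simp add: set_eq_subset)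
      show "card T \<le> 5" if "two_packing (kneser_graph n r) T" for T
        \<comment> \<open>The value is 30 - 96 + 60 = -6.\<close>
        by (rule packing_le[OF _ that, of _ 2]) (use assms 2 in simp)
    qed
    with 2 show ?thesis
      by simp
  next
    case 3
    \<comment> \<open>The point 1 and three blocks of r - 1 points use up all 3r - 2 points.\<close>
    define A B C where "A = {1..r}" and "B = insert 1 {r+1..2*r-1}" and "C = insert 1 {2*r..3*r-2}"
    note defs = this
    have Int: "A \<inter> B = {1}" "A \<inter> C = {1}" "B \<inter> C = {1}"
      unfolding defs using 3 by auto
    have card: "card A = r" "card B = r" "card C = r"
      unfolding defs using 3 by auto
    have sub: "A \<subseteq> {1..n}" "B \<subseteq> {1..n}" "C \<subseteq> {1..n}"
      unfolding defs using assms 3 by auto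
    \<comment> \<open>Were two of the sets equal, their intersection \<open>{1}\<close> would have
      \<open>r\<close> elements.\<close>
    have "r \<noteq> card {1::nat}"
      using 3 by simp
    then have ne: "A \<noteq> B" "A \<noteq> C" "B \<noteq> C"
      using Int card by (metis Int_absorb)+
    have "packing_number (kneser_graph n r) = 3"
    proof (rule packing_number_eqI)
      show "two_packing (kneser_graph n r) {A, B, C}"
        unfolding packing_iff using Int card sub by (simp add: Int_commute)
      show "card {A, B, C} = 3"
        using ne by simp
      show "card T \<le> 3" if "two_packing (kneser_graph n r) T" for T
        \<comment> \<open>The value is 12 - 8r + 2(3r - 2) = 8 - 2r, negative exactly from r = 5
          on.\<close>
        by (rule packing_le[OF _ that, of _ 1]) (use assms 3 in simp)
    qed
    with 3 show ?thesis
      by simp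
  qed
qed

end
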